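(* For every integer $n\ge0$, the misère monoid $\mathcal{M}_{\mathrm{cl}(\mathsf{L}(\tau^{2n}))}$ has exactly two elements, namely the equivalence classes of $0$ and $*$.
   Context: A position $\xi=\{\xi^L \mid \xi^R\}$ is given recursively by finite sets of Left and Right options; $\cdot$ denotes an empty set. $0=\{\cdot\mid\cdot\}$, $*=\{0\mid0\}$, $\tau^0=*$, $\tau^k=\{\tau^{k-1}\mid\tau^{k-1}\}$ for $k\ge1$, and $\mathsf{L}(\xi)=\{\xi\mid\cdot\}$. Disjunctive sum: $\alpha+\beta=\{\alpha^L+\beta,\alpha+\beta^L \mid \alpha^R+\beta,\alpha+\beta^R\}$. Under misère play a player unable to move on their turn wins; $o^-$ denotes misère outcome ($\mathcal{L}$, $\mathcal{R}$, $\mathcal{N}$ next player wins, $\mathcal{P}$ next player loses). $\mathrm{cl}(\xi)$ is the smallest set containing $\xi$ closed under disjunctive sum and taking options. For closed $\Gamma$, $\alpha\equiv\beta\pmod\Gamma$ iff $o^-(\alpha+\gamma)=o^-(\beta+\gamma)$ for all $\gamma\in\Gamma$; the misère monoid $\mathcal{M}_\Gamma$ is the set of $\equiv$-classes with the monoid operation induced by disjunctive sum. *)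

theory Defs
  imports "HOL-Library.FSet" "HOL-Algebra.Group"
begin

datatype game = Game (lopts: "game fset") (ropts: "game fset")

lemma size_lopts: "x |\<in>| lopts g \<Longrightarrow> size x < size g"
proof -
  assume "x |\<in>| lopts g"
  then have "Suc (size x) \<le> (\<Sum>y\<in>fset (lopts g). Suc (size y))"
    by (intro member_le_sum) auto
  then show ?thesis by (cases g) simp
qed

lemma size_ropts: "x |\<in>| ropts g \<Longrightarrow> size x < size g"
proof -
  assume "x |\<in>| ropts g"
  then have "Suc (size x) \<le> (\<Sum>y\<in>fset (ropts g). Suc (size y))"
    by (intro member_le_sum) auto
  then show ?thesis by (cases g) simp
qed

lemma fimage_cong_fundef [fundef_cong]:
  "A = B \<Longrightarrow> (\<And>x. x |\<in>| B \<Longrightarrow> f x = g x) \<Longrightarrow> f |`| A = g |`| B"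
  by (auto intro: fset.map_cong)

instantiation game :: "{zero, plus}"
begin

definition zero_game :: game where
  "0 = Game {||} {||}"

function plus_game :: "game \<Rightarrow> game \<Rightarrow> game" where
  "a + b = Game
     (((\<lambda>a'. a' + b) |`| lopts a) |\<union>| ((\<lambda>b'. a + b') |`| lopts b))
     (((\<lambda>a'. a' + b) |`| ropts a) |\<union>| ((\<lambda>b'. a + b') |`| ropts b))"
  by pat_completeness auto
termination
  by (relation "measure (\<lambda>(a, b). size a + size b)") (auto simp: size_lopts size_ropts)

instance ..

end

declare plus_game.simps [simp del]

definition star :: game where
  "star = Game {|0|} {|0|}"

primrec tau :: "nat \<Rightarrow> game" where
  "tau 0 = star"
| "tau (Suc k) = Game {|tau k|} {|tau k|}"

definition L_of :: "game \<Rightarrow> game" where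
  "L_of g = Game {|g|} {||}"

datatype player = Left | Right

fun opponent :: "player \<Rightarrow> player" where
  "opponent Left = Right"
| "opponent Right = Left"

fun opts :: "player \<Rightarrow> game \<Rightarrow> game fset" where
  "opts Left g = lopts g"
| "opts Right g = ropts g"

lemma size_opts: "x |\<in>| opts p g \<Longrightarrow> size x < size g"
  by (cases p) (auto simp: size_lopts size_ropts)

text \<open>\<open>wins_first p g\<close>: player \<open>p\<close>, to move in \<open>g\<close>, wins under misere play.\<close>
function wins_first :: "player \<Rightarrow> game \<Rightarrow> bool" where
  "wins_first p g \<longleftrightarrow>
     opts p g = {||} \<or> (\<exists>g' \<in> fset (opts p g). \<not> wins_first (opponent p) g')"
  by pat_completeness auto
termination
  by (relation "measure (\<lambda>(p, g). size g)") (auto simp: size_opts)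

declare wins_first.simps [simp del]

datatype outcome = LeftWins | RightWins | NextWins | PreviousWins

definition misere_outcome :: "game \<Rightarrow> outcome" where
  "misere_outcome g =
     (if wins_first Left g
      then (if wins_first Right g then NextWins else LeftWins)
      else (if wins_first Right g then RightWins else PreviousWins))"

inductive_set cl :: "game \<Rightarrow> game set" for g :: game where
  base: "g \<in> cl g"
| sum: "a \<in> cl g \<Longrightarrow> b \<in> cl g \<Longrightarrow> a + b \<in> cl g"
| lopt: "a \<in> cl g \<Longrightarrow> a' |\<in>| lopts a \<Longrightarrow> a' \<in> cl g"
| ropt: "a \<in> cl g \<Longrightarrow> a' |\<in>| ropts a \<Longrightarrow> a' \<in> cl g"

definition misere_equiv :: "game set \<Rightarrow> game \<Rightarrow> game \<Rightarrow> bool" where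
  "misere_equiv \<Gamma> a b \<longleftrightarrow> (\<forall>c\<in>\<Gamma>. misere_outcome (a + c) = misere_outcome (b + c))"

definition misere_rel :: "game set \<Rightarrow> (game \<times> game) set" where
  "misere_rel \<Gamma> = {(a, b). a \<in> \<Gamma> \<and> b \<in> \<Gamma> \<and> misere_equiv \<Gamma> a b}"

definition misere_class :: "game set \<Rightarrow> game \<Rightarrow> game set" where
  "misere_class \<Gamma> a = misere_rel \<Gamma> `` {a}"

definition misere_monoid :: "game set \<Rightarrow> game set monoid" where
  "misere_monoid \<Gamma> =
     \<lparr>carrier = \<Gamma> // misere_rel \<Gamma>,
      mult = (\<lambda>X Y. \<Union>a\<in>X. \<Union>b\<in>Y. misere_class \<Gamma> (a + b)),
      one = misere_class \<Gamma> 0\<rparr>"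

lemma lopts_plus [simp]:
  "lopts (a + b) = ((\<lambda>a'. a' + b) |`| lopts a) |\<union>| ((\<lambda>b'. a + b') |`| lopts b)"
  by (subst plus_game.simps) simp

lemma ropts_plus [simp]:
  "ropts (a + b) = ((\<lambda>a'. a' + b) |`| ropts a) |\<union>| ((\<lambda>b'. a + b') |`| ropts b)"
  by (subst plus_game.simps) simp

lemma game_plus_0: "a + 0 = (a :: game)"
proof (induction "size a" arbitrary: a rule: less_induct)
  case less
  have "(\<lambda>x. x + 0) |`| lopts a = id |`| lopts a" "(\<lambda>x. x + 0) |`| ropts a = id |`| ropts a"
    using less by (auto intro!: fset.map_cong simp: size_lopts size_ropts)
  then show ?case
    by (intro game.expand) (simp add: zero_game_def)
qed

lemma game_plus_commute: "a + b = b + (a :: game)"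
proof (induction "size a + size b" arbitrary: a b rule: less_induct)
  case less
  have "(\<lambda>x. x + b) |`| lopts a = (\<lambda>x. b + x) |`| lopts a"
    "(\<lambda>x. x + b) |`| ropts a = (\<lambda>x. b + x) |`| ropts a"
    "(\<lambda>x. a + x) |`| lopts b = (\<lambda>x. x + a) |`| lopts b"
    "(\<lambda>x. a + x) |`| ropts b = (\<lambda>x. x + a) |`| ropts b"
    using less by (auto intro!: fset.map_cong simp: size_lopts size_ropts)
  then show ?case
    by (intro game.expand) (simp add: funion_commute)
qed

lemma game_plus_assoc: "a + b + c = a + (b + c :: game)"
proof (induction "size a + size b + size c" arbitrary: a b c rule: less_induct)
  case less
  have "(\<lambda>x. x + b + c) |`| lopts a = (\<lambda>x. x + (b + c)) |`| lopts a"
    "(\<lambda>x. x + b + c) |`| ropts a = (\<lambda>x. x + (b + c)) |`| ropts a"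
    "(\<lambda>x. a + x + c) |`| lopts b = (\<lambda>x. a + (x + c)) |`| lopts b"
    "(\<lambda>x. a + x + c) |`| ropts b = (\<lambda>x. a + (x + c)) |`| ropts b"
    "(\<lambda>x. a + b + x) |`| lopts c = (\<lambda>x. a + (b + x)) |`| lopts c"
    "(\<lambda>x. a + b + x) |`| ropts c = (\<lambda>x. a + (b + x)) |`| ropts c"
    using less by (auto intro!: fset.map_cong simp: size_lopts size_ropts)
  then show ?case
    by (intro game.expand) (simp add: fimage_funion fset.map_comp comp_def funion_assoc)
qed

instance game :: comm_monoid_add
  by standard (metis game_plus_assoc game_plus_commute game_plus_0)+

lemma zero_in_cl: "0 \<in> cl g"
proof -
  have "a \<in> cl g \<Longrightarrow> 0 \<in> cl g" for a
  proof (induction "size a" arbitrary: a rule: less_induct)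
    case less
    show ?case
    proof (cases "lopts a = {||} \<and> ropts a = {||}")
      case True
      then have "a = 0" by (cases a) (simp add: zero_game_def)
      with less show ?thesis by simp
    next
      case False
      then show ?thesis
        using less cl.lopt cl.ropt size_lopts size_ropts by (metis all_not_fin_conv)
    qed
  qed
  then show ?thesis using cl.base by blast
qed

lemma equiv_misere_rel: "equiv \<Gamma> (misere_rel \<Gamma>)"
  by (auto simp: equiv_def refl_on_def sym_def trans_def misere_rel_def misere_equiv_def)

lemma misere_class_mult:
  assumes "\<And>x y. x \<in> \<Gamma> \<Longrightarrow> y \<in> \<Gamma> \<Longrightarrow> x + y \<in> \<Gamma>" "a \<in> \<Gamma>" "b \<in> \<Gamma>"
  shows "misere_class \<Gamma> a \<otimes>\<^bsub>misere_monoid \<Gamma>\<^esub> misere_class \<Gamma> b = misere_class \<Gamma> (a + b)"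
proof -
  have "misere_class \<Gamma> (x + y) = misere_class \<Gamma> (a + b)"
    if "x \<in> misere_class \<Gamma> a" "y \<in> misere_class \<Gamma> b" for x y
  proof -
    have xy: "x \<in> \<Gamma>" "y \<in> \<Gamma>" "misere_equiv \<Gamma> a x" "misere_equiv \<Gamma> b y"
      using that by (auto simp: misere_class_def misere_rel_def)
    have "misere_outcome (a + b + c) = misere_outcome (x + y + c)" if "c \<in> \<Gamma>" for c
    proof -
      have "misere_outcome (a + (b + c)) = misere_outcome (x + (b + c))"
        using xy that assms by (auto simp: misere_equiv_def)
      also have "\<dots> = misere_outcome (b + (x + c))" by (simp add: add.left_commute)
      also have "\<dots> = misere_outcome (y + (x + c))"
        using xy that assms by (auto simp: misere_equiv_def)
      finally show ?thesis by (simp add: ac_simps)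
    qed
    then have "(a + b, x + y) \<in> misere_rel \<Gamma>"
      using xy assms by (auto simp: misere_rel_def misere_equiv_def)
    then show ?thesis
      unfolding misere_class_def using equiv_class_eq[OF equiv_misere_rel] by metis
  qed
  moreover have "a \<in> misere_class \<Gamma> a" "b \<in> misere_class \<Gamma> b"
    using assms by (auto simp: misere_class_def misere_rel_def misere_equiv_def)
  ultimately have "(\<Union>x\<in>misere_class \<Gamma> a. \<Union>y\<in>misere_class \<Gamma> b. misere_class \<Gamma> (x + y))
      = misere_class \<Gamma> (a + b)"
    by blast
  then show ?thesis by (simp add: misere_monoid_def)
qed

lemma comm_monoid_misere_monoid:
  assumes "\<And>x y. x \<in> \<Gamma> \<Longrightarrow> y \<in> \<Gamma> \<Longrightarrow> x + y \<in> \<Gamma>" "0 \<in> \<Gamma>"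
  shows "comm_monoid (misere_monoid \<Gamma>)"
proof -
  have c: "carrier (misere_monoid \<Gamma>) = misere_class \<Gamma> ` \<Gamma>"
    by (auto simp: misere_monoid_def misere_class_def quotient_def)
  have o: "\<one>\<^bsub>misere_monoid \<Gamma>\<^esub> = misere_class \<Gamma> 0"
    by (simp add: misere_monoid_def)
  show ?thesis
    by (rule comm_monoidI) (auto simp: c o misere_class_mult assms ac_simps)
qed

end

theory Submission
  imports Defs
begin

text \<open>
  Every position in the closure has a parity: each move, by either player, changes it, and in an
  odd position both players can move. Hence a player to move wins exactly in the even
  positions. The parity is additive, so the class of a position depends on its parity alone.
\<close>

text \<open>In \<open>parity_graded b g\<close>, the flag \<open>b\<close> is true iff \<open>g\<close> is odd.\<close>

inductive parity_graded :: "bool \<Rightarrow> game \<Rightarrow> bool" where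
  parity_gradedI:
    "(\<And>p x. x |\<in>| opts p g \<Longrightarrow> parity_graded (\<not> b) x) \<Longrightarrow>
     (\<And>p. b \<Longrightarrow> opts p g \<noteq> {||}) \<Longrightarrow> parity_graded b g"

lemma parity_graded_opts: "parity_graded b g \<Longrightarrow> x |\<in>| opts p g \<Longrightarrow> parity_graded (\<not> b) x"
  by (auto elim: parity_graded.cases)

lemma parity_graded_opts_nonempty: "parity_graded True g \<Longrightarrow> opts p g \<noteq> {||}"
  by (auto elim: parity_graded.cases)

lemma opts_plus:
  "opts p (a + b) = ((\<lambda>a'. a' + b) |`| opts p a) |\<union>| ((\<lambda>b'. a + b') |`| opts p b)"
  by (cases p) simp_all

text \<open>The flag \<open>a \<noteq> b\<close> is the sum of the parities mod 2. A move in
  \<open>g + h\<close> flips the parity of exactly one summand; if the sum is odd, so is one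
  summand, and that one supplies a move for either player.\<close>

lemma parity_graded_plus:
  "parity_graded a g \<Longrightarrow> parity_graded b h \<Longrightarrow> parity_graded (a \<noteq> b) (g + h)"
proof (induction "size g + size h" arbitrary: a b g h rule: less_induct)
  case less
  show ?case
  proof (rule parity_gradedI)
    fix p x
    assume "x |\<in>| opts p (g + h)"
    then consider g' where "g' |\<in>| opts p g" "x = g' + h" | h' where "h' |\<in>| opts p h" "x = g + h'"
      by (auto simp: opts_plus)
    then show "parity_graded (\<not> (a \<noteq> b)) x"
    proof cases
      case 1
      then have "parity_graded ((\<not> a) \<noteq> b) x"
        using less.hyps[of g' h "\<not> a" b] less.prems by (simp add: size_opts parity_graded_opts)
      then show ?thesis by simp
    next
      case 2
      then have "parity_graded (a \<noteq> (\<not> b)) x"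
        using less.hyps[of g h' a "\<not> b"] less.prems by (simp add: size_opts parity_graded_opts)
      then show ?thesis by simp
    qed
  next
    fix p
    assume "a \<noteq> b"
    then show "opts p (g + h) \<noteq> {||}"
      using less.prems parity_graded_opts_nonempty by (cases a) (auto simp: opts_plus)
  qed
qed

text \<open>In an odd position there is a move, and each one hands the opponent an even position. In
  an even position, having no move wins at once, and otherwise any move leaves an odd
  position.\<close>

lemma wins_first_parity_graded: "parity_graded b g \<Longrightarrow> wins_first p g \<longleftrightarrow> \<not> b"
proof (induction arbitrary: p rule: parity_graded.induct)
  case (parity_gradedI g b)
  \<comment> \<open>All options have flag \<open>\<not> b\<close>, so the induction hypothesis turns
    the condition on each of them into the same one, \<open>\<not> b\<close>.\<close>
  then have "wins_first p g \<longleftrightarrow> opts p g = {||} \<or> (\<exists>x \<in> fset (opts p g). \<not> b)"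
    by (subst wins_first.simps) auto
  with parity_gradedI show ?case by auto
qed

lemma misere_outcome_parity_graded:
  "parity_graded b g \<Longrightarrow> misere_outcome g = (if b then PreviousWins else NextWins)"
  by (simp add: misere_outcome_def wins_first_parity_graded)

lemma parity_graded_cl:
  assumes "parity_graded b g" "x \<in> cl g"
  shows "\<exists>c. parity_graded c x"
  using assms(2)
proof induction
  case (lopt a a')
  then show ?case using parity_graded_opts[of _ a a' Left] by auto
next
  case (ropt a a')
  then show ?case using parity_graded_opts[of _ a a' Right] by auto
qed (use assms(1) parity_graded_plus in blast)+

text \<open>Every test position in \<open>cl g\<close> has a parity of its own, so adding it to
  \<open>x\<close> and to \<open>y\<close> gives sums of equal parity, hence of equal
  outcome.\<close>

lemma misere_equiv_parity_graded:
  assumes "parity_graded b g" "parity_graded c x" "parity_graded c y"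
  shows "misere_equiv (cl g) x y"
  unfolding misere_equiv_def
  using assms parity_graded_cl parity_graded_plus misere_outcome_parity_graded by metis

lemma parity_graded_zero: "parity_graded False 0"
proof (rule parity_gradedI)
  show "parity_graded (\<not> False) x" if "x |\<in>| opts p 0" for p x
    using that by (cases p) (simp_all add: zero_game_def)
qed simp

lemma parity_graded_star: "parity_graded True star"
proof (rule parity_gradedI)
  show "parity_graded (\<not> True) x" if "x |\<in>| opts p star" for p x
    using that by (cases p) (simp_all add: star_def parity_graded_zero)
  show "opts p star \<noteq> {||}" for p
    by (cases p) (simp_all add: star_def)
qed

text \<open>The sequence starts at the odd position \<open>star\<close>, so the parity of the
  position is opposite to that of its index.\<close>

lemma parity_graded_tau: "parity_graded (even k) (tau k)"
proof (induction k)
  case (Suc k)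
  show ?case
  proof (rule parity_gradedI)
    show "parity_graded (\<not> even (Suc k)) x" if "x |\<in>| opts p (tau (Suc k))" for p x
      using that Suc by (cases p) simp_all
    show "opts p (tau (Suc k)) \<noteq> {||}" for p
      by (cases p) simp_all
  qed
qed (simp add: parity_graded_star)

text \<open>Right has no move in \<open>L_of g\<close>, which only an even position may allow; so
  \<open>g\<close> has to be odd. This is where the even index of \<open>tau\<close> enters.\<close>

lemma parity_graded_L_of: "parity_graded True g \<Longrightarrow> parity_graded False (L_of g)"
proof (rule parity_gradedI)
  show "parity_graded (\<not> False) x" if "parity_graded True g" "x |\<in>| opts p (L_of g)" for p x
    using that by (cases p) (simp_all add: L_of_def)
qed simp

text \<open>Descending through options leads from \<open>tau k\<close> to \<open>tau 0\<close>. This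
  puts the class of \<open>star\<close> into the monoid.\<close>

lemma star_in_cl_of_tau: "tau k \<in> cl g \<Longrightarrow> star \<in> cl g"
proof (induction k)
  case (Suc k)
  then have "tau k \<in> cl g"
    using cl.lopt[of "tau (Suc k)" g "tau k"] by simp
  then show ?case by (rule Suc.IH)
qed simp

lemma carrier_misere_monoid_parity_graded:
  assumes g: "parity_graded b g" and star: "star \<in> cl g"
  shows "carrier (misere_monoid (cl g)) = {misere_class (cl g) 0, misere_class (cl g) star}"
    and "misere_class (cl g) 0 \<noteq> misere_class (cl g) star"
proof -
  have class_eq: "misere_class (cl g) x = misere_class (cl g) y \<longleftrightarrow> misere_equiv (cl g) x y"
    if "x \<in> cl g" "y \<in> cl g" for x y
    using eq_equiv_class_iff[OF equiv_misere_rel that] that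
    by (simp add: misere_class_def misere_rel_def)
  have "misere_class (cl g) x \<in> {misere_class (cl g) 0, misere_class (cl g) star}"
    if x: "x \<in> cl g" for x
  proof -
    obtain c where "parity_graded c x"
      using parity_graded_cl[OF g x] by blast
    then have "misere_equiv (cl g) x 0 \<or> misere_equiv (cl g) x star"
      using misere_equiv_parity_graded[OF g] parity_graded_zero parity_graded_star by metis
    then show ?thesis
      using class_eq[OF x zero_in_cl] class_eq[OF x star] by blast
  qed
  moreover have "carrier (misere_monoid (cl g)) = misere_class (cl g) ` cl g"
    by (auto simp: misere_monoid_def misere_class_def quotient_def)
  ultimately show "carrier (misere_monoid (cl g)) = {misere_class (cl g) 0, misere_class (cl g) star}"
    using zero_in_cl star by auto
  \<comment> \<open>The test position \<open>0\<close> separates the two classes: the player to move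
    wins in \<open>0\<close> and loses in \<open>star\<close>.\<close>
  have "misere_outcome (0 + 0) \<noteq> misere_outcome (star + 0)"
    by (simp add: misere_outcome_parity_graded[OF parity_graded_zero]
        misere_outcome_parity_graded[OF parity_graded_star])
  then show "misere_class (cl g) 0 \<noteq> misere_class (cl g) star"
    using class_eq[OF zero_in_cl star] zero_in_cl by (auto simp: misere_equiv_def)
qed

theorem theorem3p4p7:
  fixes n :: nat
  shows "carrier (misere_monoid (cl (L_of (tau (2 * n))))) =
           {misere_class (cl (L_of (tau (2 * n)))) 0, misere_class (cl (L_of (tau (2 * n)))) star}
       \<and> card (carrier (misere_monoid (cl (L_of (tau (2 * n)))))) = 2"
proof -
  let ?g = "L_of (tau (2 * n))"
  have g: "parity_graded False ?g"
    using parity_graded_tau[of "2 * n"] by (simp add: parity_graded_L_of)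
  have "tau (2 * n) \<in> cl ?g"
    by (rule cl.lopt[OF cl.base]) (simp add: L_of_def)
  then have "star \<in> cl ?g"
    by (rule star_in_cl_of_tau)
  from carrier_misere_monoid_parity_graded[OF g this] show ?thesis
    by simp
qed

end
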